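(* Let $p\neq 5$ be an odd prime, and let $\alpha_p$ be the integer with $1\le \alpha_p\le 4$ and $\alpha_p p\equiv 1 \pmod 5$. Then, in the polynomial ring $\mathbb{Z}[q]$, $$\mathcal{F}_{p+1}(q)\equiv \tfrac12\Big(1+\Big(\tfrac{5}{p}\Big)\Big)\pmod{[p]_q}$$ and $$\mathcal{F}_{p}(q)\equiv \Big(\tfrac{5}{p}\Big)\, q^{((5-\alpha_p)p+1)/5}\pmod{[p]_q}.$$
   Context: The $q$-Fibonacci polynomials $\mathcal{F}_n(q)$ (Schur) are defined by $\mathcal{F}_0(q)=0$, $\mathcal{F}_1(q)=1$, and $\mathcal{F}_n(q)=\mathcal{F}_{n-1}(q)+q^{n-2}\mathcal{F}_{n-2}(q)$ for $n\ge 2$. For a non-negative integer $n$, $[n]_q=\frac{1-q^n}{1-q}=1+q+\cdots+q^{n-1}$. $\big(\tfrac{\cdot}{p}\big)$ denotes the Legendre symbol. A congruence $f\equiv g\pmod{h}$ of polynomials means $h$ divides $f-g$ in $\mathbb{Z}[q]$. *)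

theory Defs
  imports
    "HOL-Computational_Algebra.Polynomial"
    "HOL-Number_Theory.Number_Theory"
begin

abbreviation qvar :: "int poly" where
  "qvar \<equiv> [:0, 1:]"

fun qfib :: "nat \<Rightarrow> int poly" where
  "qfib 0 = 0"
| "qfib (Suc 0) = 1"
| "qfib (Suc (Suc n)) = qfib (Suc n) + qvar ^ n * qfib n"

definition qint :: "nat \<Rightarrow> int poly" where
  "qint n = (\<Sum>i<n. qvar ^ i)"

lemma qint_mult: "(1 - qvar) * qint n = 1 - qvar ^ n"
  unfolding qint_def by (rule one_diff_power_eq [symmetric])

text \<open>Divisibility is in \<open>\<int>[q]\<close>. The library's \<^const>\<open>cong\<close> is not available on
  \<^typ>\<open>int poly\<close>, which is not a Euclidean ring.\<close>

definition qcong :: "int poly \<Rightarrow> int poly \<Rightarrow> int poly \<Rightarrow> bool" where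
  "qcong f g h \<longleftrightarrow> h dvd f - g"

end

theory Submission
  imports Defs
begin

text \<open>Schur's finite form of the Rogers--Ramanujan identities writes \<open>\<F>\<^bsub>n+1\<^esub>\<close> as the alternating
  sum of \<open>(-1)\<^sup>j q\<^bsup>j(5j+1)/2\<^esup>\<close> times the Gaussian binomial with upper index \<open>n\<close> and lower index
  \<open>\<lfloor>(n - 5j)/2\<rfloor>\<close>, over all integers \<open>j\<close>. For \<open>n = p\<close> every Gaussian binomial whose lower
  index is neither \<open>0\<close> nor \<open>p\<close> vanishes modulo \<open>[p]\<^sub>q\<close>. For \<open>n = p - 1\<close> the terms
  \<open>j = 2i\<close> and \<open>j = 2i - 1\<close> cancel modulo \<open>[p]\<^sub>q\<close> unless exactly one of their lower indices
  lies in \<open>{0..p-1}\<close>; this happens for exactly one \<open>i\<close>, and quadratic reciprocity identifies the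
  surviving sign.\<close>

section \<open>Powers and Gaussian binomials with integer indices\<close>

text \<open>Negative exponents give the junk value \<open>1\<close>; they only ever multiply a vanishing \<open>qbin\<close>.\<close>

definition qpow :: "int \<Rightarrow> int poly" where
  "qpow k = qvar ^ nat k"

lemma qpow_0 [simp]: "qpow 0 = 1"
  by (simp add: qpow_def)

lemma qpow_add: "0 \<le> a \<Longrightarrow> 0 \<le> b \<Longrightarrow> qpow (a + b) = qpow a * qpow b"
  by (simp add: qpow_def nat_add_distrib power_add)

text \<open>A single q-Pascal rule, with no division, keeps the Gaussian binomial in Z[q]. The
  integer lower index lets it vanish outside \<open>0..n\<close>, so shifted indices need no side
  conditions.\<close>

fun qbin :: "nat \<Rightarrow> int \<Rightarrow> int poly" where
  "qbin 0 k = (if k = 0 then 1 else 0)"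
| "qbin (Suc n) k = qbin n k + qpow (int n + 1 - k) * qbin n (k - 1)"

lemma qbin_eq_0: "k < 0 \<or> int n < k \<Longrightarrow> qbin n k = 0"
  by (induction n arbitrary: k) auto

lemma qbin_0_right [simp]: "qbin n 0 = 1"
  by (induction n) (auto simp: qbin_eq_0)

lemma qbin_self: "qbin n (int n) = 1"
  by (induction n) (auto simp: qbin_eq_0)

text \<open>Outside \<open>0..n\<close> the binomial is zero and both sides vanish, so the exponents
  have to be nonnegative and add up only for lower indices in range.\<close>

lemma qpow_mult_qbin_cong:
  assumes "\<lbrakk>0 \<le> k; k \<le> int n\<rbrakk> \<Longrightarrow> 0 \<le> a \<and> 0 \<le> b \<and> a + b = c"
  shows "qpow a * (qpow b * qbin n k) = qpow c * qbin n k"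
proof (cases "0 \<le> k \<and> k \<le> int n")
  case True
  with assms have "0 \<le> a" "0 \<le> b" "c = a + b" by auto
  then show ?thesis by (simp add: qpow_add mult.assoc)
next
  case False
  then show ?thesis by (auto simp: qbin_eq_0 not_le)
qed

text \<open>The mirror q-Pascal rule: expand both entries of row \<open>n + 1\<close> by the
  induction hypothesis, then regroup by the defining rule.\<close>

lemma qbin_Suc': "qbin (Suc n) k = qpow k * qbin n k + qbin n (k - 1)"
proof (induction n arbitrary: k)
  case 0
  show ?case by auto
next
  case (Suc n)
  \<comment> \<open>The middle binomial carries the same total exponent n + 1 in both
    groupings.\<close>
  have e: "qpow (int n + 2 - k) * (qpow (k - 1) * qbin n (k - 1))
      = qpow (int n + 1) * qbin n (k - 1)"
    "qpow k * (qpow (int n + 1 - k) * qbin n (k - 1)) = qpow (int n + 1) * qbin n (k - 1)"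
    by (rule qpow_mult_qbin_cong; simp)+
  have "qbin (Suc (Suc n)) k = qbin (Suc n) k + qpow (int n + 2 - k) * qbin (Suc n) (k - 1)"
    by (simp add: algebra_simps)
  also have "\<dots> = (qpow k * qbin n k + qbin n (k - 1))
      + qpow (int n + 2 - k) * (qpow (k - 1) * qbin n (k - 1) + qbin n (k - 2))"
    unfolding Suc.IH by simp
  also have "\<dots> = qpow k * (qbin n k + qpow (int n + 1 - k) * qbin n (k - 1))
      + (qbin n (k - 1) + qpow (int n + 2 - k) * qbin n (k - 2))"
    unfolding distrib_left e by (simp only: ac_simps)
  also have "\<dots> = qpow k * qbin (Suc n) k + qbin (Suc n) (k - 1)"
    by (simp add: algebra_simps)
  finally show ?case .
qed

lemma qint_mult_qpow: "(1 - qvar) * qint n = 1 - qpow (int n)"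
  by (simp only: qint_mult qpow_def nat_int)

text \<open>The absorption identity, which stands in for the quotient formula. Equating the two
  q-Pascal rules for one entry relates neighbours in row \<open>n\<close>; the nonzero factor 1 - q
  is cancelled at the end.\<close>

lemma qint_mult_qbin:
  assumes "k \<le> n"
  shows "qint k * qbin (Suc n) (int k) = qint (Suc n) * qbin n (int k - 1)"
proof -
  let ?B = "qbin n (int k)" and ?C = "qbin n (int k - 1)" and ?r = "qpow (int n + 1 - int k)"
  have rk: "?r * qpow (int k) = qpow (int (Suc n))"
    using assms by (subst qpow_add [symmetric]) (auto simp: add.commute)
  have "?B + ?r * ?C = qpow (int k) * ?B + ?C"
    using qbin_Suc' [of n "int k"] by simp
  then have "(1 - qpow (int k)) * ?B = (1 - ?r) * ?C"
    by (simp only: algebra_simps)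
  then have "(1 - qpow (int k)) * qbin (Suc n) (int k)
      = (1 - ?r) * ?C + (1 - qpow (int k)) * (?r * ?C)"
    by (simp only: qbin.simps distrib_left)
  also have "\<dots> = (1 - ?r * qpow (int k)) * ?C"
    by (simp only: algebra_simps)
  finally have "(1 - qpow (int k)) * qbin (Suc n) (int k) = (1 - qpow (int (Suc n))) * ?C"
    unfolding rk .
  then have "(1 - qvar) * (qint k * qbin (Suc n) (int k)) = (1 - qvar) * (qint (Suc n) * ?C)"
    by (simp only: qint_mult_qpow mult.assoc [symmetric])
  then show ?thesis
    by (subst (asm) mult_left_cancel) (auto simp: one_pCons)
qed

section \<open>Schur's formula\<close>

text \<open>The index \<open>i\<close> pairs the terms \<open>j = 2i\<close> and \<open>j = 2i - 1\<close> of Schur's sum; \<open>a\<close> and \<open>b\<close> carry the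
  parity-dependent values of the floor. \<open>N\<close> is any bound beyond which all terms vanish.\<close>

definition schur_sum :: "int \<Rightarrow> nat \<Rightarrow> int \<Rightarrow> int \<Rightarrow> int poly" where
  "schur_sum N n a b = (\<Sum>i = -N..N. qpow (i * (10 * i + 1)) * qbin n (a - 5 * i)
     - qpow ((2 * i - 1) * (5 * i - 2)) * qbin n (b - 5 * i))"

lemma exponents_nonneg:
  "0 \<le> i * (10 * i + 1)" "0 \<le> (2 * i - 1) * (5 * i - 2)" for i :: int
  by (cases "0 \<le> i"; cases "1 \<le> i"; simp add: zero_le_mult_iff)+

lemma sum_int_telescope:
  fixes g :: "int \<Rightarrow> 'a::ab_group_add"
  assumes "a \<le> b + 1"
  shows "(\<Sum>i = a..b. g i - g (i - 1)) = g b - g (a - 1)"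
proof -
  have "(\<Sum>i = a..a + int n - 1. g i - g (i - 1)) = g (a + int n - 1) - g (a - 1)" for n
  proof (induction n)
    case (Suc n)
    have "{a..a + int (Suc n) - 1} = insert (a + int n) {a..a + int n - 1}" by auto
    with Suc show ?case by (simp add: algebra_simps)
  qed simp
  from this [of "nat (b + 1 - a)"] show ?thesis using assms by simp
qed

text \<open>The Fibonacci recurrence holds for each \<open>i\<close> separately. The two halves of a
  summand are expanded by the two q-Pascal rules in opposite orders, and each leaves over one
  multiple of the same binomial.\<close>

lemma schur_sum_even:
  "schur_sum N (2 * m + 2) (int m + 1) (int m + 3)
     = schur_sum N (2 * m + 1) (int m) (int m + 3)
       + qpow (2 * int m + 1) * schur_sum N (2 * m) (int m) (int m + 2)"
  unfolding schur_sum_def sum_distrib_left sum.distrib [symmetric]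
proof (rule sum.cong [OF refl])
  fix i :: int
  let ?m = "int m"
  define E F where "E = qpow (i * (10 * i + 1))" and "F = qpow ((2 * i - 1) * (5 * i - 2))"
  have a: "qbin (2 * m + 2) (?m + 1 - 5 * i) = qbin (2 * m + 1) (?m - 5 * i)
      + qpow (?m + 1 - 5 * i) * (qpow (?m + 5 * i) * qbin (2 * m) (?m - 5 * i)
        + qbin (2 * m) (?m + 1 - 5 * i))"
    using qbin_Suc' [of "2 * m + 1" "?m + 1 - 5 * i"]
    by (simp add: algebra_simps)
  have b: "qbin (2 * m + 2) (?m + 3 - 5 * i) = qbin (2 * m + 1) (?m + 3 - 5 * i)
      + qpow (?m - 1 + 5 * i) * (qpow (?m + 2 - 5 * i) * qbin (2 * m) (?m + 2 - 5 * i)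
        + qbin (2 * m) (?m + 1 - 5 * i))"
    using qbin_Suc' [of "2 * m" "?m + 2 - 5 * i"]
    by (simp add: algebra_simps)
  have c: "qpow (?m + 1 - 5 * i) * (qpow (?m + 5 * i) * qbin (2 * m) (?m - 5 * i))
      = qpow (2 * ?m + 1) * qbin (2 * m) (?m - 5 * i)"
    "qpow (?m - 1 + 5 * i) * (qpow (?m + 2 - 5 * i) * qbin (2 * m) (?m + 2 - 5 * i))
      = qpow (2 * ?m + 1) * qbin (2 * m) (?m + 2 - 5 * i)"
    by (rule qpow_mult_qbin_cong; simp)+
  \<comment> \<open>The leftovers of the two halves agree, so they cancel in the difference.\<close>
  have d: "E * (qpow (?m + 1 - 5 * i) * qbin (2 * m) (?m + 1 - 5 * i))
      = qpow (10 * i * i - 4 * i + ?m + 1) * qbin (2 * m) (?m + 1 - 5 * i)"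
    "F * (qpow (?m - 1 + 5 * i) * qbin (2 * m) (?m + 1 - 5 * i))
      = qpow (10 * i * i - 4 * i + ?m + 1) * qbin (2 * m) (?m + 1 - 5 * i)"
    unfolding E_def F_def using exponents_nonneg [of i]
    by (intro qpow_mult_qbin_cong; simp add: algebra_simps)+
  have "E * qbin (2 * m + 2) (?m + 1 - 5 * i) - F * qbin (2 * m + 2) (?m + 3 - 5 * i)
    = E * qbin (2 * m + 1) (?m - 5 * i) - F * qbin (2 * m + 1) (?m + 3 - 5 * i)
      + qpow (2 * ?m + 1) * (E * qbin (2 * m) (?m - 5 * i) - F * qbin (2 * m) (?m + 2 - 5 * i))"
    unfolding a b distrib_left c d right_diff_distrib by (simp only: ac_simps)
  then show "qpow (i * (10 * i + 1)) * qbin (2 * m + 2) (int m + 1 - 5 * i)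
      - qpow ((2 * i - 1) * (5 * i - 2)) * qbin (2 * m + 2) (int m + 3 - 5 * i)
    = qpow (i * (10 * i + 1)) * qbin (2 * m + 1) (int m - 5 * i)
      - qpow ((2 * i - 1) * (5 * i - 2)) * qbin (2 * m + 1) (int m + 3 - 5 * i)
      + qpow (2 * int m + 1) * (qpow (i * (10 * i + 1)) * qbin (2 * m) (int m - 5 * i)
      - qpow ((2 * i - 1) * (5 * i - 2)) * qbin (2 * m) (int m + 2 - 5 * i))"
    unfolding E_def F_def .
qed

text \<open>Unlike in the even case, the leftovers of the two halves cancel only between
  neighbouring \<open>i\<close>, so the recurrence holds after telescoping.\<close>

lemma schur_sum_odd:
  assumes "int m < N"
  shows "schur_sum N (2 * m + 3) (int m + 1) (int m + 4)
     = schur_sum N (2 * m + 2) (int m + 1) (int m + 3)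
       + qpow (2 * int m + 2) * schur_sum N (2 * m + 1) (int m) (int m + 3)"
proof -
  let ?m = "int m"
  \<comment> \<open>The first half of summand \<open>i\<close> leaves over \<open>g i\<close>, the
    second half leaves over \<open>g (i - 1)\<close>.\<close>
  define g where "g i = qpow (10 * i * i + 6 * i + ?m + 2) * qbin (2 * m + 1) (?m - 1 - 5 * i)"
    for i
  have step: "qpow (i * (10 * i + 1)) * qbin (2 * m + 3) (?m + 1 - 5 * i)
      - qpow ((2 * i - 1) * (5 * i - 2)) * qbin (2 * m + 3) (?m + 4 - 5 * i)
    = (qpow (i * (10 * i + 1)) * qbin (2 * m + 2) (?m + 1 - 5 * i)
      - qpow ((2 * i - 1) * (5 * i - 2)) * qbin (2 * m + 2) (?m + 3 - 5 * i))
      + qpow (2 * ?m + 2) * (qpow (i * (10 * i + 1)) * qbin (2 * m + 1) (?m - 5 * i)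
      - qpow ((2 * i - 1) * (5 * i - 2)) * qbin (2 * m + 1) (?m + 3 - 5 * i))
      + (g i - g (i - 1))" for i
  proof -
    define E F where "E = qpow (i * (10 * i + 1))" and "F = qpow ((2 * i - 1) * (5 * i - 2))"
    have a: "qbin (2 * m + 3) (?m + 1 - 5 * i) = qbin (2 * m + 2) (?m + 1 - 5 * i)
        + qpow (?m + 2 + 5 * i) * (qpow (?m - 5 * i) * qbin (2 * m + 1) (?m - 5 * i)
          + qbin (2 * m + 1) (?m - 1 - 5 * i))"
      using qbin_Suc' [of "2 * m + 1" "?m - 5 * i"]
      by (simp add: algebra_simps eval_nat_numeral)
    have b: "qbin (2 * m + 3) (?m + 4 - 5 * i) = qbin (2 * m + 2) (?m + 3 - 5 * i)
        + qpow (?m + 4 - 5 * i) * (qpow (?m - 2 + 5 * i) * qbin (2 * m + 1) (?m + 3 - 5 * i)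
          + qbin (2 * m + 1) (?m + 4 - 5 * i))"
      using qbin_Suc' [of "2 * m + 2" "?m + 4 - 5 * i"]
      by (simp add: algebra_simps eval_nat_numeral)
    have c: "qpow (?m + 2 + 5 * i) * (qpow (?m - 5 * i) * qbin (2 * m + 1) (?m - 5 * i))
        = qpow (2 * ?m + 2) * qbin (2 * m + 1) (?m - 5 * i)"
      "qpow (?m + 4 - 5 * i) * (qpow (?m - 2 + 5 * i) * qbin (2 * m + 1) (?m + 3 - 5 * i))
        = qpow (2 * ?m + 2) * qbin (2 * m + 1) (?m + 3 - 5 * i)"
      by (rule qpow_mult_qbin_cong; simp)+
    have d: "E * (qpow (?m + 2 + 5 * i) * qbin (2 * m + 1) (?m - 1 - 5 * i)) = g i"
      "F * (qpow (?m + 4 - 5 * i) * qbin (2 * m + 1) (?m + 4 - 5 * i)) = g (i - 1)"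
    proof -
      show "E * (qpow (?m + 2 + 5 * i) * qbin (2 * m + 1) (?m - 1 - 5 * i)) = g i"
        unfolding E_def g_def using exponents_nonneg [of i]
        by (intro qpow_mult_qbin_cong; simp add: algebra_simps)
      have "?m - 1 - 5 * (i - 1) = ?m + 4 - 5 * i" by simp
      then show "F * (qpow (?m + 4 - 5 * i) * qbin (2 * m + 1) (?m + 4 - 5 * i)) = g (i - 1)"
        unfolding F_def g_def using exponents_nonneg [of i]
        by (simp only:) (intro qpow_mult_qbin_cong; simp add: algebra_simps)
    qed
    have "E * qbin (2 * m + 3) (?m + 1 - 5 * i) - F * qbin (2 * m + 3) (?m + 4 - 5 * i)
      = (E * qbin (2 * m + 2) (?m + 1 - 5 * i) - F * qbin (2 * m + 2) (?m + 3 - 5 * i))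
        + qpow (2 * ?m + 2) * (E * qbin (2 * m + 1) (?m - 5 * i)
          - F * qbin (2 * m + 1) (?m + 3 - 5 * i)) + (g i - g (i - 1))"
      unfolding a b distrib_left c d right_diff_distrib by (simp only: ac_simps)
    then show ?thesis unfolding E_def F_def .
  qed
  have "(\<Sum>i = -N..N. g i - g (i - 1)) = g N - g (- N - 1)"
    using assms by (intro sum_int_telescope) simp
  \<comment> \<open>Since m < N, both boundary terms have a lower index outside
    \<open>0..2 * m + 1\<close>.\<close>
  also have "\<dots> = 0"
    using assms by (simp add: g_def qbin_eq_0)
  finally show ?thesis
    unfolding schur_sum_def sum_distrib_left step sum.distrib by simp
qed

text \<open>Both parities are proved together because the recurrence alternates between them. The
  bound \<open>N\<close> stays fixed so that all sums have the same range.\<close>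

lemma qfib_eq_schur_sum:
  assumes "int m \<le> N"
  shows "qfib (2 * m + 1) = schur_sum N (2 * m) (int m) (int m + 2)"
    and "qfib (2 * m + 2) = schur_sum N (2 * m + 1) (int m) (int m + 3)"
proof -
  have "qfib (2 * m + 1) = schur_sum N (2 * m) (int m) (int m + 2)
    \<and> qfib (2 * m + 2) = schur_sum N (2 * m + 1) (int m) (int m + 3)"
    using assms
  proof (induction m)
    case 0
    \<comment> \<open>These are the coincidences that would make a further binomial of row 0 or 1
      nonzero; only the first half of the summand \<open>i = 0\<close> survives.\<close>
    have ne: "5 * i \<noteq> 2" "5 * i \<noteq> 3" "- (5 * i) \<noteq> 1" for i :: int by presburger+
    have "schur_sum N 0 0 2 = (\<Sum>i = -N..N. if i = 0 then 1 else 0)"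
      unfolding schur_sum_def using ne by (intro sum.cong) auto
    moreover have "schur_sum N 1 0 3 = (\<Sum>i = -N..N. if i = 0 then 1 else 0)"
      unfolding schur_sum_def using ne by (intro sum.cong) (auto simp: algebra_simps)
    ultimately show ?case using 0 by (simp add: numeral_2_eq_2)
  next
    case (Suc m)
    then have IH: "qfib (2 * m + 1) = schur_sum N (2 * m) (int m) (int m + 2)"
      "qfib (2 * m + 2) = schur_sum N (2 * m + 1) (int m) (int m + 3)"
      by auto
    have "qfib (2 * m + 3) = qfib (2 * m + 2) + qpow (2 * int m + 1) * qfib (2 * m + 1)"
      by (simp add: eval_nat_numeral qpow_def nat_add_distrib nat_mult_distrib)
    then have a: "qfib (2 * m + 3) = schur_sum N (2 * m + 2) (int m + 1) (int m + 3)"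
      unfolding schur_sum_even IH .
    have "qfib (2 * m + 4) = qfib (2 * m + 3) + qpow (2 * int m + 2) * qfib (2 * m + 2)"
      by (simp add: eval_nat_numeral qpow_def nat_add_distrib nat_mult_distrib)
    then have "qfib (2 * m + 4) = schur_sum N (2 * m + 3) (int m + 1) (int m + 4)"
      using Suc.prems unfolding a IH by (subst schur_sum_odd) auto
    with a show ?case by (simp add: algebra_simps eval_nat_numeral)
  qed
  then show "qfib (2 * m + 1) = schur_sum N (2 * m) (int m) (int m + 2)"
    and "qfib (2 * m + 2) = schur_sum N (2 * m + 1) (int m) (int m + 3)" by auto
qed

section \<open>Reduction modulo \<open>[p]\<^sub>q\<close>\<close>

lemma qcong_refl [simp]: "qcong f f h"
  by (simp add: qcong_def)

lemma qcong_trans [trans]: "qcong f g h \<Longrightarrow> qcong g k h \<Longrightarrow> qcong f k h"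
  unfolding qcong_def using dvd_add [of h "f - g" "g - k"] by simp

lemma qcong_sym: "qcong f g h \<Longrightarrow> qcong g f h"
  using dvd_minus_iff [of h "f - g"] by (simp add: qcong_def)

lemma qcong_diff: "qcong f g h \<Longrightarrow> qcong f' g' h \<Longrightarrow> qcong (f - f') (g - g') h"
  unfolding qcong_def using dvd_diff [of h "f - g" "f' - g'"] by (simp add: algebra_simps)

lemma qcong_minus: "qcong f g h \<Longrightarrow> qcong (- f) (- g) h"
  using qcong_diff [of 0 0 h f g] by simp

lemma qcong_mult:
  assumes "qcong f g h" "qcong f' g' h"
  shows "qcong (f * f') (g * g') h"
proof -
  have "f * f' - g * g' = (f - g) * f' + g * (f' - g')" by (simp only: algebra_simps)
  then show ?thesis using assms unfolding qcong_def by (simp only:) auto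
qed

lemma qcong_power: "qcong f g h \<Longrightarrow> qcong (f ^ n) (g ^ n) h"
  by (induction n) (simp_all add: qcong_mult)

lemma qcong_sum_single:
  assumes "finite A" "i \<in> A" "qcong (f i) c h"
    and "\<And>j. j \<in> A \<Longrightarrow> j \<noteq> i \<Longrightarrow> qcong (f j) 0 h"
  shows "qcong (sum f A) c h"
proof -
  have "h dvd sum f (A - {i})"
    using assms(4) by (intro dvd_sum) (auto simp: qcong_def)
  then have "h dvd (f i - c) + sum f (A - {i})"
    using assms(3) by (auto simp: qcong_def)
  then show ?thesis
    using assms(1,2) by (simp add: qcong_def sum.remove [of A i] algebra_simps)
qed

lemma qcong_sum_0: "(\<And>j. j \<in> A \<Longrightarrow> qcong (f j) 0 h) \<Longrightarrow> qcong (sum f A) 0 h"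
  by (auto simp: qcong_def intro: dvd_sum)

text \<open>Exponents matter only modulo p, because 1 - q^p = (1 - q) [p]_q.\<close>

lemma qcong_qpow:
  assumes "0 \<le> a" "0 \<le> b" "[a = b] (mod int p)"
  shows "qcong (qpow a) (qpow b) (qint p)"
proof -
  have one: "qcong (qvar ^ p) 1 (qint p)"
  proof -
    have "qvar ^ p - 1 = qint p * (qvar - 1)"
      using qint_mult [of p] by (simp only: algebra_simps)
    then show ?thesis unfolding qcong_def by (metis dvd_triv_left)
  qed
  have red: "qcong (qvar ^ (j + p * k)) (qvar ^ j) (qint p)" for j k
    using qcong_mult [OF qcong_refl [of "qvar ^ j"] qcong_power [OF one, of k]]
    by (simp only: power_add power_mult power_one mult_1_right)
  have "[nat a = nat b] (mod p)"
    using assms by (simp add: cong_int_iff [symmetric])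
  then obtain k l where kl: "nat b + p * k = nat a + p * l"
    unfolding cong_iff_lin_nat by (auto simp: mult.commute)
  have "qcong (qvar ^ nat a) (qvar ^ (nat a + p * l)) (qint p)"
    by (rule qcong_sym [OF red])
  also have "qcong (qvar ^ (nat a + p * l)) (qvar ^ nat b) (qint p)"
    unfolding kl [symmetric] by (rule red)
  finally show ?thesis unfolding qpow_def .
qed

section \<open>Gaussian binomials in rows p and p - 1 modulo [p]_q\<close>

lemma qint_dvd_qint:
  assumes "a dvd b"
  shows "qint a dvd qint b"
proof -
  from assms obtain k where b: "b = a * k" ..
  have "(1 - qvar) * qint b = 1 - (qvar ^ a) ^ k"
    by (simp only: qint_mult b power_mult)
  also have "\<dots> = (1 - qvar) * (qint a * (\<Sum>i<k. (qvar ^ a) ^ i))"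
    by (simp only: one_diff_power_eq mult.assoc [symmetric] qint_mult)
  finally show ?thesis
    by (subst (asm) mult_left_cancel) (auto simp: one_pCons)
qed

lemma qint_Suc: "qint (Suc n) = 1 + qvar * qint n"
  unfolding qint_def by (simp only: sum.lessThan_Suc_shift power_0 power_Suc sum_distrib_left)

text \<open>No irreducibility of [p]_q is used. For 0 < j < p choose x and t with j x = 1 + p t;
  then [j]_q divides [j x]_q = 1 + q [p t]_q, which is 1 modulo [p]_q. So [j]_q is a unit there and
  can be cancelled from the absorption identity.\<close>

lemma qbin_prime_cong_0:
  assumes "prime p" "k \<noteq> 0" "k \<noteq> int p"
  shows "qcong (qbin p k) 0 (qint p)"
proof (cases "0 \<le> k \<and> k \<le> int p")
  case True
  define j where "j = nat k"
  have k: "k = int j" and j: "0 < j" "j < p"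
    using True assms by (auto simp: j_def)
  have "coprime p j"
    using assms(1) j by (intro prime_imp_coprime) (auto dest: dvd_imp_le)
  then obtain x where "[j * x = 1] (mod p)"
    using cong_solve_coprime_nat [of j p] by (auto simp: coprime_commute)
  moreover have "j * x \<noteq> 0"
    using calculation j by (cases "x = 0") (auto simp: cong_def)
  ultimately obtain t where t: "j * x = Suc (p * t)"
    by (metis One_nat_def Suc_pred' add.commute cong_to_1_nat dvdE
        gr0I plus_1_eq_Suc)
  have "qint j dvd 1 + qvar * qint (p * t)"
    unfolding qint_Suc [symmetric] t [symmetric] by (intro qint_dvd_qint) simp
  \<comment> \<open>\<open>u\<close> is the inverse of [j]_q modulo [p]_q.\<close>
  then obtain u where u: "1 + qvar * qint (p * t) = qint j * u" ..
  obtain n where n: "p = Suc n" using j by (cases p) auto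
  have "qint j * qbin p k = qint p * qbin n (k - 1)"
    using qint_mult_qbin [of j n] j by (simp only: n k)
  then have "qint p dvd u * (qint j * qbin p k)" by simp
  also have "u * (qint j * qbin p k) = (1 + qvar * qint (p * t)) * qbin p k"
    unfolding u by (simp only: ac_simps)
  also have "\<dots> = qbin p k + qint (p * t) * (qvar * qbin p k)"
    by (simp only: algebra_simps)
  finally have "qint p dvd qbin p k + qint (p * t) * (qvar * qbin p k)" .
  moreover have "qint p dvd qint (p * t) * (qvar * qbin p k)"
    by (intro dvd_mult2 qint_dvd_qint) simp
  ultimately show ?thesis
    unfolding qcong_def by (metis diff_zero dvd_add_left_iff)
qed (use assms in \<open>auto simp: qbin_eq_0\<close>)

text \<open>An inner entry of row p vanishes modulo [p]_q, so each q-Pascal rule expresses one of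
  two neighbours in row p - 1 by the other.\<close>

lemma qbin_pred_prime_cong:
  assumes "prime (Suc n)" "0 < k" "k \<le> int n"
  shows "qcong (qbin n k) (- (qpow (int n + 1 - k) * qbin n (k - 1))) (qint (Suc n))"
    and "qcong (qbin n (k - 1)) (- (qpow k * qbin n k)) (qint (Suc n))"
proof -
  have "qint (Suc n) dvd qbin (Suc n) k"
    using qbin_prime_cong_0 [OF assms(1), of k] assms(2,3) by (simp add: qcong_def del: qbin.simps)
  then show "qcong (qbin n k) (- (qpow (int n + 1 - k) * qbin n (k - 1))) (qint (Suc n))"
    and "qcong (qbin n (k - 1)) (- (qpow k * qbin n k)) (qint (Suc n))"
    by (simp add: qcong_def)
       (use \<open>qint (Suc n) dvd qbin (Suc n) k\<close> in
         \<open>simp only: qcong_def qbin_Suc' diff_minus_eq_add add.commute\<close>)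
qed

section \<open>The Fibonacci polynomials at p and p + 1 modulo [p]_q\<close>

definition schur_term :: "nat \<Rightarrow> int \<Rightarrow> int poly" where
  "schur_term m i = qpow (i * (10 * i + 1)) * qbin (2 * m) (int m - 5 * i)
     - qpow ((2 * i - 1) * (5 * i - 2)) * qbin (2 * m) (int m + 2 - 5 * i)"

text \<open>The two lower indices are k and k + 2. If both are in range, two neighbour steps turn
  one binomial into the other with sign +1, and the halves cancel. Otherwise both binomials are
  zero.\<close>

lemma schur_term_cong_0:
  assumes "prime (2 * m + 1)"
    and "k = int m - 5 * i" "0 \<le> k \<and> k + 2 \<le> int (2 * m) \<or> k + 2 < 0 \<or> int (2 * m) < k"
  shows "qcong (schur_term m i) 0 (qint (2 * m + 1))"
proof (cases "0 \<le> k \<and> k + 2 \<le> int (2 * m)")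
  case True
  define n where "n = 2 * m"
  define F where "F = qpow ((2 * i - 1) * (5 * i - 2))"
  have n: "prime (Suc n)" "int n = 2 * int m" "2 * m + 1 = Suc n"
    using assms(1) by (auto simp: n_def)
  have k: "0 \<le> k" "k + 2 \<le> int n" using True by (auto simp: n_def)
  have "qcong (qbin n (k + 2)) (- (qpow (int n - 1 - k) * qbin n (k + 1))) (qint (Suc n))"
    using qbin_pred_prime_cong(1) [OF n(1), of "k + 2"] k by (simp add: algebra_simps)
  also have "qcong (- (qpow (int n - 1 - k) * qbin n (k + 1)))
      (- (qpow (int n - 1 - k) * - (qpow (int n - k) * qbin n k))) (qint (Suc n))"
    using qbin_pred_prime_cong(1) [OF n(1), of "k + 1"] k
    by (intro qcong_minus qcong_mult qcong_refl) (simp add: algebra_simps)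
  also have "- (qpow (int n - 1 - k) * - (qpow (int n - k) * qbin n k))
      = qpow (2 * int n - 1 - 2 * k) * qbin n k"
    using qpow_add [of "int n - 1 - k" "int n - k"] k by (simp add: algebra_simps)
  finally have "qcong (F * qbin n (k + 2)) (F * (qpow (2 * int n - 1 - 2 * k) * qbin n k))
      (qint (Suc n))"
    by (intro qcong_mult qcong_refl)
  \<comment> \<open>With k = m - 5i the exponent exceeds that of the first half by exactly
    p.\<close>
  also have "F * (qpow (2 * int n - 1 - 2 * k) * qbin n k)
      = qpow (i * (10 * i + 1) + int (Suc n)) * qbin n k"
    unfolding F_def using k exponents_nonneg [of i] assms(2) n(2)
    by (intro qpow_mult_qbin_cong) (simp_all add: algebra_simps)
  also have "qcong (qpow (i * (10 * i + 1) + int (Suc n)) * qbin n k)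
      (qpow (i * (10 * i + 1)) * qbin n k) (qint (Suc n))"
    using exponents_nonneg [of i]
    by (intro qcong_mult qcong_refl qcong_qpow) (auto simp: cong_def)
  finally have "qcong (F * qbin n (k + 2)) (qpow (i * (10 * i + 1)) * qbin n k) (qint (Suc n))" .
  then have "qcong (schur_term m i)
      (qpow (i * (10 * i + 1)) * qbin n k - qpow (i * (10 * i + 1)) * qbin n k) (qint (Suc n))"
    unfolding schur_term_def F_def n_def assms(2)
    by (intro qcong_diff qcong_refl) (simp add: algebra_simps)
  then show ?thesis by (simp only: n diff_self)
next
  case False
  with assms(3) have "k + 2 < 0 \<or> int (2 * m) < k" by blast
  then show ?thesis
    unfolding schur_term_def assms(2) by (auto simp: qbin_eq_0)
qed

text \<open>The four listed values are those k for which exactly one of k and k + 2 lies in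
  \<open>0..2 * m\<close>, so every other summand vanishes.\<close>

lemma qfib_prime_cong_term:
  assumes "prime (2 * m + 1)" "- int m \<le> i" "i \<le> int m"
    and "qcong (schur_term m i) c (qint (2 * m + 1))"
    and "\<And>j. int m - 5 * j \<in> {- 2, - 1, int (2 * m) - 1, int (2 * m)} \<Longrightarrow> j = i"
  shows "qcong (qfib (2 * m + 1)) c (qint (2 * m + 1))"
proof -
  have "qfib (2 * m + 1) = (\<Sum>i = - int m..int m. schur_term m i)"
    unfolding qfib_eq_schur_sum(1) [OF order_refl] schur_sum_def schur_term_def ..
  also have "qcong \<dots> c (qint (2 * m + 1))"
  proof (rule qcong_sum_single [where f = "schur_term m", OF _ _ assms(4)])
    fix j assume "j \<noteq> i"
    then have "int m - 5 * j \<notin> {- 2, - 1, int (2 * m) - 1, int (2 * m)}"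
      using assms(5) by blast
    then show "qcong (schur_term m j) 0 (qint (2 * m + 1))"
      by (intro schur_term_cong_0 [OF assms(1) refl]) auto
  qed (use assms(2,3) in auto)
  finally show ?thesis .
qed

text \<open>In row p only the lower indices 0 and p survive. For the first half of summand
  \<open>i\<close> they amount to m = 5i and m + 1 = -5i.\<close>

lemma qfib_Suc_prime_cong:
  assumes p: "prime (2 * m + 1)" "\<not> 5 dvd 2 * m + 1"
  shows "\<lbrakk>int m = 5 * i \<or> int m + 1 = - 5 * i\<rbrakk> \<Longrightarrow> qcong (qfib (2 * m + 2)) 1 (qint (2 * m + 1))"
    and "\<lbrakk>\<And>j. int m \<noteq> 5 * j \<and> int m + 1 \<noteq> - 5 * j\<rbrakk>
      \<Longrightarrow> qcong (qfib (2 * m + 2)) 0 (qint (2 * m + 1))"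
proof -
  define f where "f j = qpow (j * (10 * j + 1)) * qbin (2 * m + 1) (int m - 5 * j)
     - qpow ((2 * j - 1) * (5 * j - 2)) * qbin (2 * m + 1) (int m + 3 - 5 * j)" for j
  have fib: "qfib (2 * m + 2) = (\<Sum>j = - int m..int m. f j)"
    unfolding qfib_eq_schur_sum(2) [OF order_refl] schur_sum_def f_def ..
  have f: "qcong (f j) (qpow (j * (10 * j + 1)) * c) (qint (2 * m + 1))"
    if "qcong (qbin (2 * m + 1) (int m - 5 * j)) c (qint (2 * m + 1))" for j c
  proof -
    \<comment> \<open>The second half never survives: either equality would force 5 to divide
      p.\<close>
    have "int m + 3 - 5 * j \<noteq> 0" "int m + 3 - 5 * j \<noteq> int (2 * m + 1)"
      using p(2) by presburger+
    then have "qcong (f j)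
        (qpow (j * (10 * j + 1)) * c - qpow ((2 * j - 1) * (5 * j - 2)) * 0) (qint (2 * m + 1))"
      unfolding f_def
      by (intro qcong_diff qcong_mult qcong_refl that qbin_prime_cong_0 p(1))
    then show ?thesis by simp
  qed
  have f0: "qcong (f j) 0 (qint (2 * m + 1))" if "int m \<noteq> 5 * j" "int m + 1 \<noteq> - 5 * j" for j
    using f [OF qbin_prime_cong_0 [OF p(1)], of j] that by simp
  show "qcong (qfib (2 * m + 2)) 0 (qint (2 * m + 1))"
    if "\<And>j. int m \<noteq> 5 * j \<and> int m + 1 \<noteq> - 5 * j"
    unfolding fib using that by (intro qcong_sum_0 f0) auto
  show "qcong (qfib (2 * m + 2)) 1 (qint (2 * m + 1))" if i: "int m = 5 * i \<or> int m + 1 = - 5 * i"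
  proof -
    have "int m - 5 * i = 0 \<or> int m - 5 * i = int (2 * m + 1)" using i by auto
    then have "qbin (2 * m + 1) (int m - 5 * i) = 1"
      by (elim disjE) (simp_all only: qbin_0_right qbin_self)
    then have "qcong (f i) (qpow (i * (10 * i + 1))) (qint (2 * m + 1))"
      using f [of i 1] by simp
    also have "qcong (qpow (i * (10 * i + 1))) (qpow 0) (qint (2 * m + 1))"
    proof (rule qcong_qpow)
      \<comment> \<open>The exponent is thus a multiple of p, and the surviving power is 1.\<close>
      have "10 * i + 1 = int (2 * m + 1) \<or> 10 * i + 1 = - int (2 * m + 1)"
        using i by auto
      then show "[i * (10 * i + 1) = 0] (mod int (2 * m + 1))"
        unfolding cong_0_iff by (elim disjE) (simp_all only: dvd_triv_right dvd_minus_iff mult_minus_right)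
    qed (use exponents_nonneg [of i] in auto)
    finally have fi: "qcong (f i) 1 (qint (2 * m + 1))" by simp
    show ?thesis
      unfolding fib
    proof (rule qcong_sum_single [where f = f, OF _ _ fi])
      show "i \<in> {- int m..int m}" using i by auto
      fix j assume "j \<noteq> i"
      \<comment> \<open>Two different surviving indices would satisfy one alternative each; adding
        the two equations makes 5 divide p.\<close>
      moreover have "int (2 * m + 1) \<noteq> 5 * x" for x
        using p(2) by (metis dvd_triv_left int_dvd_int_iff of_nat_numeral)
      from this [of "i - j"] this [of "j - i"]
      have "int (2 * m + 1) \<noteq> 5 * (i - j)" "int (2 * m + 1) \<noteq> 5 * (j - i)" .
      ultimately have "int m \<noteq> 5 * j \<and> int m + 1 \<noteq> - 5 * j" using i by auto
      then show "qcong (f j) 0 (qint (2 * m + 1))" by (intro f0) auto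
    qed simp
  qed
qed

lemma qcong_qpow_qvar:
  "\<lbrakk>0 \<le> a; [a = int b] (mod int p)\<rbrakk> \<Longrightarrow> qcong (qpow a) (qvar ^ b) (qint p)"
  using qcong_qpow [of a "int b" p] by (simp add: qpow_def)

text \<open>In the four cases the surviving summand has lower index k = 2m, 2m - 1, -2 and -1
  respectively. The stated exponents are those of the theorem for p = 10t + 1, 10t + 3, 10t + 7, 10t
  + 9.\<close>

lemma qfib_prime_cong:
  assumes pr: "prime (2 * m + 1)"
  shows "m = 5 * t \<Longrightarrow> qcong (qfib (2 * m + 1)) (qvar ^ (8 * t + 1)) (qint (2 * m + 1))"
    and "m = 5 * t + 1 \<Longrightarrow> qcong (qfib (2 * m + 1)) (- (qvar ^ (6 * t + 2))) (qint (2 * m + 1))"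
    and "m = 5 * t + 3 \<Longrightarrow> qcong (qfib (2 * m + 1)) (- (qvar ^ (4 * t + 3))) (qint (2 * m + 1))"
    and "m = 5 * t + 4 \<Longrightarrow> qcong (qfib (2 * m + 1)) (qvar ^ (2 * t + 2)) (qint (2 * m + 1))"
proof -
  let ?p = "2 * m + 1" and ?t = "int t"
  have pr': "prime (Suc (2 * m))" using pr by simp
  have m: "m > 0" using pr by (cases m) auto
  show "qcong (qfib ?p) (qvar ^ (8 * t + 1)) (qint ?p)" if mt: "m = 5 * t"
  proof (rule qfib_prime_cong_term [OF pr, where i = "- ?t"])
    have "qbin (2 * m) (int m - 5 * (- ?t)) = 1"
      using qbin_self [of "2 * m"] by (simp add: mt)
    moreover have "qbin (2 * m) (int m + 2 - 5 * (- ?t)) = 0"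
      by (rule qbin_eq_0) (simp add: mt)
    ultimately have "schur_term m (- ?t) = qpow (?t * (10 * ?t - 1))"
      unfolding schur_term_def by (simp add: algebra_simps)
    also have "qcong (qpow (?t * (10 * ?t - 1))) (qvar ^ (8 * t + 1)) (qint ?p)"
    proof (rule qcong_qpow_qvar)
      have "?t * (10 * ?t - 1) - int (8 * t + 1) = int ?p * (?t - 1)"
        by (simp add: mt algebra_simps)
      then show "[?t * (10 * ?t - 1) = int (8 * t + 1)] (mod int ?p)"
        unfolding cong_iff_dvd_diff by simp
      show "0 \<le> ?t * (10 * ?t - 1)" using exponents_nonneg(1) [of "- ?t"] by (simp add: algebra_simps)
    qed
    finally show "qcong (schur_term m (- ?t)) (qvar ^ (8 * t + 1)) (qint ?p)" .
  qed (use mt in \<open>(auto; presburger)+\<close>)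
  show "qcong (qfib ?p) (- (qvar ^ (6 * t + 2))) (qint ?p)" if mt: "m = 5 * t + 1"
  proof (rule qfib_prime_cong_term [OF pr, where i = "- ?t"])
    have "qbin (2 * m) (int m + 2 - 5 * (- ?t)) = 0"
      by (rule qbin_eq_0) (simp add: mt)
    then have "schur_term m (- ?t) = qpow (?t * (10 * ?t - 1)) * qbin (2 * m) (int (2 * m) - 1)"
      unfolding schur_term_def by (simp add: algebra_simps mt)
    \<comment> \<open>The sign arises here: one step in from the end of row 2m, where the entry is
      1, costs a factor -q^(2m).\<close>
    also have "qcong (qpow (?t * (10 * ?t - 1)) * qbin (2 * m) (int (2 * m) - 1))
        (qpow (?t * (10 * ?t - 1)) * - (qpow (int (2 * m)) * 1)) (qint ?p)"
      using qbin_pred_prime_cong(2) [OF pr', of "int (2 * m)"] m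
      by (intro qcong_mult qcong_refl) (simp only: qbin_self; simp)
    also have "qpow (?t * (10 * ?t - 1)) * - (qpow (int (2 * m)) * 1)
        = - qpow (?t * (10 * ?t - 1) + int (2 * m))"
      using exponents_nonneg(1) [of "- ?t"] by (subst qpow_add) (auto simp: algebra_simps)
    also have "qcong (- qpow (?t * (10 * ?t - 1) + int (2 * m))) (- (qvar ^ (6 * t + 2))) (qint ?p)"
    proof (intro qcong_minus qcong_qpow_qvar)
      have "?t * (10 * ?t - 1) + int (2 * m) - int (6 * t + 2) = int ?p * ?t"
        by (simp add: mt algebra_simps)
      then show "[?t * (10 * ?t - 1) + int (2 * m) = int (6 * t + 2)] (mod int ?p)"
        unfolding cong_iff_dvd_diff by simp
      show "0 \<le> ?t * (10 * ?t - 1) + int (2 * m)"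
        using exponents_nonneg(1) [of "- ?t"] by (simp add: algebra_simps)
    qed
    finally show "qcong (schur_term m (- ?t)) (- (qvar ^ (6 * t + 2))) (qint ?p)" .
  qed (use mt in \<open>(auto; presburger)+\<close>)
  show "qcong (qfib ?p) (- (qvar ^ (4 * t + 3))) (qint ?p)" if mt: "m = 5 * t + 3"
  proof (rule qfib_prime_cong_term [OF pr, where i = "?t + 1"])
    have "qbin (2 * m) (int m - 5 * (?t + 1)) = 0"
      by (rule qbin_eq_0) (simp add: mt)
    moreover have "qbin (2 * m) (int m + 2 - 5 * (?t + 1)) = 1"
      by (simp add: mt)
    ultimately have "schur_term m (?t + 1) = - qpow ((2 * ?t + 1) * (5 * ?t + 3))"
      unfolding schur_term_def by (simp add: algebra_simps)
    also have "qcong (- qpow ((2 * ?t + 1) * (5 * ?t + 3))) (- (qvar ^ (4 * t + 3))) (qint ?p)"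
    proof (intro qcong_minus qcong_qpow_qvar)
      have "(2 * ?t + 1) * (5 * ?t + 3) - int (4 * t + 3) = int ?p * ?t"
        by (simp add: mt algebra_simps)
      then show "[(2 * ?t + 1) * (5 * ?t + 3) = int (4 * t + 3)] (mod int ?p)"
        unfolding cong_iff_dvd_diff by simp
    qed simp
    finally show "qcong (schur_term m (?t + 1)) (- (qvar ^ (4 * t + 3))) (qint ?p)" .
  qed (use mt in \<open>(auto; presburger)+\<close>)
  show "qcong (qfib ?p) (qvar ^ (2 * t + 2)) (qint ?p)" if mt: "m = 5 * t + 4"
  proof (rule qfib_prime_cong_term [OF pr, where i = "?t + 1"])
    have "qbin (2 * m) (int m - 5 * (?t + 1)) = 0"
      by (rule qbin_eq_0) (simp add: mt)
    then have "schur_term m (?t + 1) = - (qpow ((2 * ?t + 1) * (5 * ?t + 3)) * qbin (2 * m) 1)"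
      unfolding schur_term_def by (simp add: algebra_simps mt)
    \<comment> \<open>The entry next to \<open>qbin (2 * m) 0\<close> brings a second minus sign,
      which offsets that of the second half.\<close>
    also have "qcong (- (qpow ((2 * ?t + 1) * (5 * ?t + 3)) * qbin (2 * m) 1))
        (- (qpow ((2 * ?t + 1) * (5 * ?t + 3)) * - (qpow (int (2 * m)) * 1))) (qint ?p)"
      using qbin_pred_prime_cong(1) [OF pr', of 1] m
      by (intro qcong_minus qcong_mult qcong_refl) simp
    also have "- (qpow ((2 * ?t + 1) * (5 * ?t + 3)) * - (qpow (int (2 * m)) * 1))
        = qpow ((2 * ?t + 1) * (5 * ?t + 3) + int (2 * m))"
      by (subst qpow_add) auto
    also have "qcong (qpow ((2 * ?t + 1) * (5 * ?t + 3) + int (2 * m))) (qvar ^ (2 * t + 2)) (qint ?p)"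
    proof (rule qcong_qpow_qvar)
      have "(2 * ?t + 1) * (5 * ?t + 3) + int (2 * m) - int (2 * t + 2) = int ?p * (?t + 1)"
        by (simp add: mt algebra_simps)
      then show "[(2 * ?t + 1) * (5 * ?t + 3) + int (2 * m) = int (2 * t + 2)] (mod int ?p)"
        unfolding cong_iff_dvd_diff by simp
    qed simp
    finally show "qcong (schur_term m (?t + 1)) (qvar ^ (2 * t + 2)) (qint ?p)" .
  qed (use mt in \<open>(auto; presburger)+\<close>)
qed

section \<open>The Legendre symbol of 5 and the conclusion\<close>

text \<open>Reciprocity replaces (5/p) by (p/5), which is read off from the squares modulo
  5.\<close>

lemma Legendre_5:
  fixes p :: nat
  assumes "prime p" "odd p" "p \<noteq> 5"
  shows "Legendre 5 (int p) = (if p mod 5 \<in> {1, 4} then 1 else - 1)"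
proof -
  have p2: "2 < p" using assms(1,2) prime_gt_1_nat [of p] by (cases "p = 2") auto
  have "Legendre (int 5) (int p) * Legendre (int p) (int 5)
      = (- 1) ^ ((5 - 1) div 2 * ((p - 1) div 2))"
    using p2 assms by (intro Quadratic_Reciprocity) auto
  \<comment> \<open>The sign is +1 because (5 - 1)/2 is even.\<close>
  then have rec: "Legendre 5 (int p) * Legendre (int p) 5 = 1"
    by (simp add: power_mult)
  have "\<not> 5 dvd p"
    using assms(1,3) primes_dvd_imp_eq [of 5 p] by auto
  then have mod: "p mod 5 \<in> {1, 2, 3, 4}" and nz: "\<not> [int p = 0] (mod 5)"
    by (auto simp: cong_def) presburger+
  have "QuadRes 5 (int p) \<longleftrightarrow> p mod 5 \<in> {1, 4}"
  proof
    assume "QuadRes 5 (int p)"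
    then obtain y where y: "y\<^sup>2 mod 5 = int p mod 5"
      by (auto simp: QuadRes_def cong_def)
    have "y mod 5 \<in> {0, 1, 2, 3, 4}" by auto
    moreover have "y\<^sup>2 mod 5 = (y mod 5)\<^sup>2 mod 5" by (simp add: power_mod)
    ultimately have "y\<^sup>2 mod 5 \<in> {0, 1, 4}" by auto
    then show "p mod 5 \<in> {1, 4}" using mod y by auto presburger+
  next
    assume "p mod 5 \<in> {1, 4}"
    then have "[1\<^sup>2 = int p] (mod 5) \<or> [2\<^sup>2 = int p] (mod 5)"
      unfolding cong_def by auto presburger+
    then show "QuadRes 5 (int p)" unfolding QuadRes_def by blast
  qed
  then have "Legendre (int p) 5 = (if p mod 5 \<in> {1, 4} then 1 else - 1)"
    using nz by (simp add: Legendre_def)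
  with rec show ?thesis by (auto split: if_splits)
qed

theorem theorem1p1:
  fixes p \<alpha> :: nat
  assumes "prime p" and "odd p" and "p \<noteq> 5"
    and "1 \<le> \<alpha>" and "\<alpha> \<le> 4" and "[\<alpha> * p = 1] (mod 5)"
  shows "qcong (qfib (p + 1)) [:(1 + Legendre 5 (int p)) div 2:] (qint p)
    \<and> qcong (qfib p) ([:Legendre 5 (int p):] * qvar ^ (((5 - \<alpha>) * p + 1) div 5)) (qint p)"
proof -
  from assms(2) obtain m where p: "p = 2 * m + 1" by (auto elim: oddE)
  have pr: "prime (2 * m + 1)" using assms(1) by (simp add: p)
  have nd: "\<not> 5 dvd 2 * m + 1"
    using assms(1,3) primes_dvd_imp_eq [of 5 p] by (auto simp: p)
  have \<alpha>: "\<alpha> = 1 \<or> \<alpha> = 2 \<or> \<alpha> = 3 \<or> \<alpha> = 4" "\<alpha> * p mod 5 = 1"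
    using assms(4-6) by (auto simp: cong_def)
  define t where "t = m div 5"
  have "m mod 5 = 0 \<or> m mod 5 = 1 \<or> m mod 5 = 3 \<or> m mod 5 = 4"
    using nd by presburger
  \<comment> \<open>The case names are the residues of p modulo 10; m = 2 modulo 5 would make 5
    divide p.\<close>
  then consider (1) "m = 5 * t" | (3) "m = 5 * t + 1" | (7) "m = 5 * t + 3" | (9) "m = 5 * t + 4"
    using mult_div_mod_eq [of 5 m] unfolding t_def by fastforce
  then show ?thesis
  proof cases
    case 1
    have L: "Legendre 5 (int p) = 1"
      using Legendre_5 [OF assms(1-3)] by (simp add: p 1) presburger
    have "\<alpha> = 1" using \<alpha> unfolding p 1 by safe presburger+
    then have e: "((5 - \<alpha>) * p + 1) div 5 = 8 * t + 1" by (simp add: p 1)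
    show ?thesis
      using qfib_prime_cong(1) [OF pr 1] qfib_Suc_prime_cong(1) [OF pr nd, of "int t"]
      unfolding L e by (simp add: 1 p one_pCons [symmetric])
  next
    case 3
    have L: "Legendre 5 (int p) = - 1"
      using Legendre_5 [OF assms(1-3)] by (simp add: p 3) presburger
    have "\<alpha> = 2" using \<alpha> unfolding p 3 by safe presburger+
    then have e: "((5 - \<alpha>) * p + 1) div 5 = 6 * t + 2" by (simp add: p 3)
    have "int m \<noteq> 5 * j \<and> int m + 1 \<noteq> - 5 * j" for j using 3 by presburger
    then show ?thesis
      using qfib_prime_cong(2) [OF pr 3] qfib_Suc_prime_cong(2) [OF pr nd]
      unfolding L e by (simp add: 3 p)
  next
    case 7
    have L: "Legendre 5 (int p) = - 1"
      using Legendre_5 [OF assms(1-3)] by (simp add: p 7) presburger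
    have "\<alpha> = 3" using \<alpha> unfolding p 7 by safe presburger+
    then have e: "((5 - \<alpha>) * p + 1) div 5 = 4 * t + 3" by (simp add: p 7)
    have "int m \<noteq> 5 * j \<and> int m + 1 \<noteq> - 5 * j" for j using 7 by presburger
    then show ?thesis
      using qfib_prime_cong(3) [OF pr 7] qfib_Suc_prime_cong(2) [OF pr nd]
      unfolding L e by (simp add: 7 p)
  next
    case 9
    have L: "Legendre 5 (int p) = 1"
      using Legendre_5 [OF assms(1-3)] by (simp add: p 9) presburger
    have "\<alpha> = 4" using \<alpha> unfolding p 9 by safe presburger+
    then have e: "((5 - \<alpha>) * p + 1) div 5 = 2 * t + 2" by (simp add: p 9)
    \<comment> \<open>Here m + 1 = 5(t + 1), so the index p is hit at i = -t - 1.\<close>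
    show ?thesis
      using qfib_prime_cong(4) [OF pr 9] qfib_Suc_prime_cong(1) [OF pr nd, of "- int t - 1"]
      unfolding L e by (simp add: 9 p one_pCons [symmetric])
  qed
qed

end
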